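(* Let $(X,d)$ be a metric space and let $T: X \to X$ be a Banach contraction, i.e. there exists $q \in (0,1)$ such that $d(Tx,Ty) \leq q\, d(x,y)$ for all $x,y \in X$. Then $T$ is a PA-contraction.
   Context: Let $(X,d)$ be a metric space. A mapping $T: X \to X$ is called a PA-contraction (Path-Averaged Contraction) if there exist $\alpha \in (0,1)$ and $N \in \mathbb{N} = \{1,2,3,\dots\}$ such that for all $x, y \in X$ and all integers $n \ge N$, $$\frac{1}{n} \sum_{k=0}^{n-1} d(T^{k+1}x, T^{k+1}y) \leq \alpha \cdot \frac{1}{n} \sum_{k=0}^{n-1} d(T^k x, T^k y).$$ Equivalently, $\sum_{k=0}^{n-1} d(T^{k+1}x, T^{k+1}y) \leq \alpha \sum_{k=0}^{n-1} d(T^k x, T^k y)$. Here $T^k$ denotes the $k$-fold composition of $T$ with itself, and $T^0$ is the identity. The constants $\alpha$ and $N$ do not depend on $x, y$. *)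

theory Defs
  imports "HOL-Analysis.Analysis"
begin

(* X is the carrier of a metric space and d its distance (cf. the locale Metric_space);
   both notions include that T maps X into itself. *)

definition banach_contraction :: "'a set \<Rightarrow> ('a \<Rightarrow> 'a \<Rightarrow> real) \<Rightarrow> ('a \<Rightarrow> 'a) \<Rightarrow> bool" where
  "banach_contraction X d T \<longleftrightarrow>
     T \<in> X \<rightarrow> X \<and>
     (\<exists>q::real. 0 < q \<and> q < 1 \<and> (\<forall>x\<in>X. \<forall>y\<in>X. d (T x) (T y) \<le> q * d x y))"

definition PA_contraction :: "'a set \<Rightarrow> ('a \<Rightarrow> 'a \<Rightarrow> real) \<Rightarrow> ('a \<Rightarrow> 'a) \<Rightarrow> bool" where
  "PA_contraction X d T \<longleftrightarrow>
     T \<in> X \<rightarrow> X \<and>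
     (\<exists>(\<alpha>::real) (N::nat). 0 < \<alpha> \<and> \<alpha> < 1 \<and> 1 \<le> N \<and>
        (\<forall>x\<in>X. \<forall>y\<in>X. \<forall>n\<ge>N.
           1 / real n * (\<Sum>k<n. d ((T ^^ (k + 1)) x) ((T ^^ (k + 1)) y))
             \<le> \<alpha> * (1 / real n * (\<Sum>k<n. d ((T ^^ k) x) ((T ^^ k) y)))))"

end

theory Submission
  imports Defs
begin

text \<open>The contraction inequality, applied to the points \<open>(T ^^ k) x\<close> and
  \<open>(T ^^ k) y\<close> of the two orbits, bounds each term of the shifted sum by
  \<open>q\<close> times the corresponding term of the original one. Summing over k and dividing by
  n preserves this, so \<alpha> = \<open>q\<close> works with threshold N = 1.\<close>

lemma funpow_in_carrier: "T \<in> X \<rightarrow> X \<Longrightarrow> x \<in> X \<Longrightarrow> (T ^^ k) x \<in> X"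
  by (induction k) auto

theorem proposition5:
  fixes X :: "'a set" and d :: "'a \<Rightarrow> 'a \<Rightarrow> real" and T :: "'a \<Rightarrow> 'a"
  assumes "Metric_space X d"
    and "banach_contraction X d T"
  shows "PA_contraction X d T"
proof -
  obtain q :: real where T: "T \<in> X \<rightarrow> X" and q: "0 < q" "q < 1"
    and contr: "\<And>x y. x \<in> X \<Longrightarrow> y \<in> X \<Longrightarrow> d (T x) (T y) \<le> q * d x y"
    using assms(2) unfolding banach_contraction_def by blast
  \<comment> \<open>The bound is uniform in n; at n = 0 both sides are 0, since
    \<open>1 / 0 = 0\<close>.\<close>
  have "1 / real n * (\<Sum>k<n. d ((T ^^ (k + 1)) x) ((T ^^ (k + 1)) y))
      \<le> q * (1 / real n * (\<Sum>k<n. d ((T ^^ k) x) ((T ^^ k) y)))"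
    if "x \<in> X" "y \<in> X" for x y n
  proof -
    have "(\<Sum>k<n. d ((T ^^ (k + 1)) x) ((T ^^ (k + 1)) y))
        \<le> (\<Sum>k<n. q * d ((T ^^ k) x) ((T ^^ k) y))"
      \<comment> \<open>\<open>contr\<close> holds only on \<open>X\<close>, so both k-th iterates
        must lie there.\<close>
      by (rule sum_mono) (simp add: contr funpow_in_carrier [OF T] that)
    also have "\<dots> = q * (\<Sum>k<n. d ((T ^^ k) x) ((T ^^ k) y))"
      by (rule sum_distrib_left [symmetric])
    finally show ?thesis
      by (simp add: mult.left_commute divide_right_mono)
  qed
  with T q show ?thesis
    unfolding PA_contraction_def by blast
qed

end
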